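(* Let $n \ge 1$ be an integer, let $a_1, \dots, a_n$ be real numbers, and let $$\mathcal{A} = \Big\{S : \emptyset \neq S \subset [n],\ \sum_{i \in S} a_i = 1\Big\}.$$ Then $$\sum_{S \in \mathcal{A}} \frac{1}{|S| \binom{n}{|S|}} \le 1.$$ Equivalently, if $\mathcal{A}_t = \{S : S \in \mathcal{A}, |S| = t\}$, then $$\sum_{t=1}^n \frac{|\mathcal{A}_t|}{t \binom{n}{t}} \le 1.$$
   Context: $[n] = \{1, \dots, n\}$; $S \subset [n]$ allows $S = [n]$. *)

theory Defs
  imports Complex_Main
begin

text \<open>Only the values \<open>a 1, \<dots>, a n\<close> matter; they need not be nonnegative or distinct.\<close>

definition unit_sum_sets :: "nat \<Rightarrow> (nat \<Rightarrow> real) \<Rightarrow> nat set set" where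
  "unit_sum_sets n a = {S. S \<noteq> {} \<and> S \<subseteq> {1..n} \<and> (\<Sum>i\<in>S. a i) = 1}"

definition unit_sum_level :: "nat \<Rightarrow> (nat \<Rightarrow> real) \<Rightarrow> nat \<Rightarrow> nat set set" where
  "unit_sum_level n a t = {S. S \<in> unit_sum_sets n a \<and> card S = t}"

end

theory Submission
  imports Defs "HOL-Combinatorics.Multiset_Permutations"
begin

text \<open>
  Since \<open>1 / (t * (n choose t)) = (t - 1)! (n - t)! / n!\<close>, it is enough to attach to each
  unit-sum set of size \<open>t\<close> at least \<open>(t - 1)! (n - t)!\<close> of the \<open>n!\<close> orderings of \<open>[n]\<close>, in
  such a way that no ordering is used twice.

  The orderings attached to a set \<open>S\<close> of size \<open>t\<close> are those in which \<open>S\<close> is the set of entries read at the first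
  moment the partial sum reaches 1: they list \<open>S\<close> so that every proper prefix has sum below 1,
  and then list the complement arbitrarily. An ordering determines this first moment, hence
  \<open>S\<close>, which gives disjointness (\<open>disjoint_first_hit_orderings\<close>). That at least one in \<open>t\<close> of the
  \<open>t!\<close> orderings of \<open>S\<close> is admissible is a cycle lemma in the spirit of Raney and Spitzer
  (\<open>cycle_lemma_unit_sum\<close>): every ordering of \<open>S\<close> has a cyclic rotation whose proper prefixes all
  have sum below 1. The weights may be negative, which is why the prefix sums need not be monotone
  and the cycle lemma is needed.
\<close>

definition proper_prefixes_below_one :: "('a \<Rightarrow> real) \<Rightarrow> 'a list \<Rightarrow> bool" where
  "proper_prefixes_below_one a xs \<longleftrightarrow> (\<forall>k<length xs. sum_list (map a (take k xs)) < 1)"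

text \<open>
  Start the rotation at the first point \<open>m\<close> where the partial sum is as large as possible. Before
  wrapping around, the new partial sums are at most 0; after wrapping around,
  they are \<open>1 + p i - p m\<close> with \<open>i < m\<close>, which is below 1 because \<open>m\<close> is the \<^emph>\<open>first\<close> maximiser.
\<close>

lemma cycle_lemma_unit_sum:
  fixes a :: "'a \<Rightarrow> real"
  assumes "xs \<noteq> []" and total: "sum_list (map a xs) = 1"
  obtains m where "m < length xs" "proper_prefixes_below_one a (rotate m xs)"
proof -
  define p where "p k = sum_list (map a (take k xs))" for k
  define t where "t = length xs"
  have t: "t > 0" using assms(1) by (simp add: t_def)
  have p0: "p 0 = 0" and pt: "p t = 1" using total by (auto simp: p_def t_def)
  define M where "M = Max (p ` {..<t})"
  have "M \<in> p ` {..<t}" unfolding M_def using t by (intro Max_in) auto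
  then have ex: "\<exists>m. m < t \<and> p m = M" by auto
  define m where "m = (LEAST m. m < t \<and> p m = M)"
  have m: "m < t" "p m = M" using LeastI_ex[OF ex] by (auto simp: m_def)
  have le: "p i \<le> p m" if "i < t" for i
    unfolding m M_def using that by simp
  have less: "p i < p m" if "i < m" for i
  proof -
    have "p i \<noteq> M" using not_less_Least[of i "\<lambda>m. m < t \<and> p m = M"] that m(1)
      by (auto simp: m_def)
    then show ?thesis using le[of i] that m by simp
  qed
  have rot: "rotate m xs = drop m xs @ take m xs"
    using m(1) by (simp add: rotate_drop_take t_def)
  have shift: "sum_list (map a (take j (drop m xs))) = p (m + j) - p m" for j
    by (simp add: p_def take_add)
  have "sum_list (map a (take j (rotate m xs))) < 1" if j: "j < t" for j
  proof (cases "m + j < t")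
    case True
    then show ?thesis
      using le[of "m + j"] shift[of j] by (simp add: rot t_def)
  next
    case False
    define i where "i = m + j - t"
    have i: "i < m" "j = (t - m) + i" using False j m by (auto simp: i_def)
    have "take j (rotate m xs) = take (t - m) (drop m xs) @ take i xs"
      using i by (simp add: rot t_def min_def)
    then have "sum_list (map a (take j (rotate m xs))) = (p t - p m) + p i"
      using shift[of "t - m"] m(1) by (simp add: p_def)
    then show ?thesis using less[OF i(1)] pt by simp
  qed
  then have "proper_prefixes_below_one a (rotate m xs)"
    by (simp add: proper_prefixes_below_one_def t_def)
  with m(1) show ?thesis using that by (simp add: t_def)
qed

definition admissible_orderings :: "('a \<Rightarrow> real) \<Rightarrow> 'a set \<Rightarrow> 'a list set" where
  "admissible_orderings a S = {xs \<in> permutations_of_set S. proper_prefixes_below_one a xs}"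

lemma finite_admissible_orderings [simp]: "finite (admissible_orderings a S)"
  by (simp add: admissible_orderings_def)

text \<open>
  Each admissible ordering has at most \<open>card S\<close> rotations, and by the cycle lemma these rotations
  exhaust the orderings of \<open>S\<close>.
\<close>

lemma card_admissible_orderings:
  assumes S: "finite S" "S \<noteq> {}" "(\<Sum>i\<in>S. a i) = (1::real)"
  shows "fact (card S - 1) \<le> card (admissible_orderings a S)"
proof -
  define t where "t = card S"
  have t: "t > 0" using S by (simp add: t_def card_gt_0_iff)
  have "permutations_of_set S
      \<subseteq> (\<lambda>(ys, k). rotate k ys) ` (admissible_orderings a S \<times> {1..t})"
  proof
    fix xs assume xs: "xs \<in> permutations_of_set S"
    have len: "length xs = t" using xs by (auto simp: permutations_of_set_def t_def distinct_card)
    have "sum_list (map a xs) = 1" "xs \<noteq> []"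
      using xs S by (auto simp: permutations_of_set_def sum_list_distinct_conv_sum_set)
    then obtain m where m: "m < t" "proper_prefixes_below_one a (rotate m xs)"
      using cycle_lemma_unit_sum len by metis
    have "rotate m xs \<in> admissible_orderings a S"
      using xs m by (simp add: admissible_orderings_def permutations_of_set_def)
    moreover have "xs = rotate (t - m) (rotate m xs)"
      using m(1) len by (simp add: rotate_rotate rotate_id)
    ultimately show "xs \<in> (\<lambda>(ys, k). rotate k ys) ` (admissible_orderings a S \<times> {1..t})"
      using m(1) by (intro image_eqI[of _ _ "(rotate m xs, t - m)"]) auto
  qed
  then have "card (permutations_of_set S) \<le> card (admissible_orderings a S \<times> {1..t})"
    by (rule surj_card_le[rotated]) simp
  then have "fact t \<le> card (admissible_orderings a S) * t"
    using S by (simp add: t_def)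
  then have "t * fact (t - 1) \<le> t * card (admissible_orderings a S)"
    using t by (simp add: fact_reduce mult.commute)
  then show ?thesis using t by (simp add: t_def)
qed

definition first_hit_orderings :: "('a \<Rightarrow> real) \<Rightarrow> 'a set \<Rightarrow> 'a set \<Rightarrow> 'a list set" where
  "first_hit_orderings a X S =
     (\<lambda>(xs, ys). xs @ ys) ` (admissible_orderings a S \<times> permutations_of_set (X - S))"

lemma first_hit_orderings_subset:
  assumes "S \<subseteq> X"
  shows "first_hit_orderings a X S \<subseteq> permutations_of_set X"
  using assms
  by (auto simp: first_hit_orderings_def admissible_orderings_def permutations_of_set_def)

lemma finite_first_hit_orderings [simp]: "finite (first_hit_orderings a X S)"
  by (simp add: first_hit_orderings_def)

lemma card_first_hit_orderings:
  assumes X: "finite X" "S \<subseteq> X" and S: "S \<noteq> {}" "(\<Sum>i\<in>S. a i) = (1::real)"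
  shows "fact (card S - 1) * fact (card X - card S) \<le> card (first_hit_orderings a X S)"
proof -
  have fin: "finite S" using X finite_subset by blast
  have "inj_on (\<lambda>(xs, ys). xs @ ys) (admissible_orderings a S \<times> permutations_of_set (X - S))"
    by (auto simp: inj_on_def admissible_orderings_def dest!: length_finite_permutations_of_set)
  then have "card (first_hit_orderings a X S)
      = card (admissible_orderings a S) * card (permutations_of_set (X - S))"
    unfolding first_hit_orderings_def by (simp add: card_image card_cartesian_product)
  also have "card (permutations_of_set (X - S)) = fact (card X - card S)"
    using X fin by (simp add: card_Diff_subset)
  finally show ?thesis using card_admissible_orderings[OF fin S] by simp
qed

text \<open>
  If one ordering belonged to both \<open>S\<close> and \<open>T\<close> with \<open>card S < card T\<close>, the listing of \<open>S\<close> would be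
  a proper prefix of the listing of \<open>T\<close>, with sum 1 instead of below 1.
\<close>

lemma disjoint_first_hit_orderings:
  assumes fin: "finite S" "finite T"
    and sums: "(\<Sum>i\<in>S. a i) = (1::real)" "(\<Sum>i\<in>T. a i) = (1::real)"
    and "S \<noteq> T"
  shows "first_hit_orderings a X S \<inter> first_hit_orderings a X T = {}"
proof -
  have prefix: "set (take (card S) zs) = S"
      "sum_list (map a (take (card S) zs)) = (\<Sum>i\<in>S. a i)"
      "\<And>k. k < card S \<Longrightarrow> sum_list (map a (take k zs)) < 1"
    if zs: "zs \<in> first_hit_orderings a X S" for zs S
  proof -
    obtain xs ys where xs: "zs = xs @ ys" "set xs = S" "distinct xs" "proper_prefixes_below_one a xs"
      using zs by (auto simp: first_hit_orderings_def admissible_orderings_def permutations_of_set_def)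
    then have len: "length xs = card S" using distinct_card by metis
    show "set (take (card S) zs) = S"
      "sum_list (map a (take (card S) zs)) = (\<Sum>i\<in>S. a i)"
      using xs len by (simp_all add: sum_list_distinct_conv_sum_set)
    show "\<And>k. k < card S \<Longrightarrow> sum_list (map a (take k zs)) < 1"
      using xs len by (simp add: proper_prefixes_below_one_def)
  qed
  have False if S: "zs \<in> first_hit_orderings a X S" and T: "zs \<in> first_hit_orderings a X T" for zs
  proof (cases "card S" "card T" rule: linorder_cases)
    case less
    then show False using prefix(3)[OF T less] prefix(2)[OF S] sums by simp
  next
    case equal
    then show False using prefix(1)[OF S] prefix(1)[OF T] assms(5) by simp
  next
    case greater
    then show False using prefix(3)[OF S greater] prefix(2)[OF T] sums by simp
  qed
  then show ?thesis by blast
qed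

lemma inverse_size_times_binomial:
  assumes "0 < t" "t \<le> n"
  shows "1 / (real t * real (n choose t)) = fact (t - 1) * fact (n - t) / fact n"
  using assms by (simp add: binomial_fact fact_reduce[of t] field_simps)

lemma sum_unit_sum_sets_le_one:
  assumes X: "finite X"
    and U: "\<And>S. S \<in> U \<Longrightarrow> S \<noteq> {} \<and> S \<subseteq> X \<and> (\<Sum>i\<in>S. a i) = (1::real)"
  shows "(\<Sum>S\<in>U. 1 / (real (card S) * real (card X choose card S))) \<le> 1"
proof -
  have finU: "finite U" by (rule finite_subset[of _ "Pow X"]) (use X U in auto)
  have finS: "finite S" if "S \<in> U" for S using U[OF that] X finite_subset by blast
  have "(\<Sum>S\<in>U. card (first_hit_orderings a X S)) = card (\<Union>S\<in>U. first_hit_orderings a X S)"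
  proof (rule card_UN_disjoint[symmetric])
    show "\<forall>S\<in>U. \<forall>T\<in>U. S \<noteq> T \<longrightarrow> first_hit_orderings a X S \<inter> first_hit_orderings a X T = {}"
      using U finS by (intro ballI impI disjoint_first_hit_orderings) auto
  qed (use finU in auto)
  also have "\<dots> \<le> card (permutations_of_set X)"
    by (intro card_mono UN_least first_hit_orderings_subset) (use U in auto)
  also have "\<dots> = fact (card X)" using X by simp
  finally have count: "(\<Sum>S\<in>U. card (first_hit_orderings a X S)) \<le> fact (card X)" .
  have "(\<Sum>S\<in>U. 1 / (real (card S) * real (card X choose card S)))
      \<le> (\<Sum>S\<in>U. real (card (first_hit_orderings a X S)) / fact (card X))"
  proof (rule sum_mono)
    fix S assume S: "S \<in> U"
    have "0 < card S" "card S \<le> card X"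
      using U[OF S] finS[OF S] X by (auto simp: card_gt_0_iff card_mono)
    moreover have "real (fact (card S - 1) * fact (card X - card S))
        \<le> real (card (first_hit_orderings a X S))"
      using card_first_hit_orderings[of X S a] X U[OF S] by (intro of_nat_mono) auto
    ultimately show "1 / (real (card S) * real (card X choose card S))
        \<le> real (card (first_hit_orderings a X S)) / fact (card X)"
      by (simp add: inverse_size_times_binomial divide_right_mono)
  qed
  also have "\<dots> = real (\<Sum>S\<in>U. card (first_hit_orderings a X S)) / fact (card X)"
    by (simp add: sum_divide_distrib)
  also have "\<dots> \<le> real (fact (card X)) / fact (card X)"
    using count by (intro divide_right_mono of_nat_mono) auto
  finally show ?thesis by simp
qed

theorem theorem1p3:
  fixes n :: nat and a :: "nat \<Rightarrow> real"
  assumes "n \<ge> 1"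
  shows "(\<Sum>S\<in>unit_sum_sets n a. 1 / (real (card S) * real (n choose card S))) \<le> 1
    \<and> (\<Sum>t=1..n. real (card (unit_sum_level n a t)) / (real t * real (n choose t))) \<le> 1"
proof -
  let ?U = "unit_sum_sets n a"
  let ?w = "\<lambda>t. 1 / (real t * real (n choose t))"
  have le: "(\<Sum>S\<in>?U. ?w (card S)) \<le> 1"
    using sum_unit_sum_sets_le_one[of "{1..n}" ?U a] by (simp add: unit_sum_sets_def)
  have "finite ?U" by (rule finite_subset[of _ "Pow {1..n}"]) (auto simp: unit_sum_sets_def)
  moreover have "card ` ?U \<subseteq> {1..n}"
  proof (rule image_subsetI)
    fix S assume S: "S \<in> ?U"
    then have "S \<subseteq> {1..n}" "S \<noteq> {}" by (auto simp: unit_sum_sets_def)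
    then show "card S \<in> {1..n}"
      using card_mono[of "{1..n}" S] finite_subset[of S "{1..n}"]
      by (simp add: Suc_le_eq card_gt_0_iff)
  qed
  ultimately have "(\<Sum>S\<in>?U. ?w (card S)) = (\<Sum>t=1..n. \<Sum>S | S \<in> ?U \<and> card S = t. ?w (card S))"
    by (intro sum.group[symmetric]) auto
  also have "\<dots> = (\<Sum>t=1..n. real (card (unit_sum_level n a t)) / (real t * real (n choose t)))"
    by (simp add: unit_sum_level_def)
  finally show ?thesis using le by simp
qed

end
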